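(* For all $r,r'>0$ the Lorentzian cylinders $C^2_r$ and $C^2_{r'}$ are isometric, an isometry $\phi_{rr'}:C^2_r\to C^2_{r'}$ being given in lightlike coordinates by $$\phi_{rr'}(x^+,x^-)=\left(\frac{r'}{r}\,x^+,\ \frac{r}{r'}\,x^-\right);$$ that is, $\phi_{rr'}^*h'=h$, where $h$ and $h'$ are the metrics of $C^2_r$ and $C^2_{r'}$, respectively.
   Context: For $r>0$, $C^2_r=[0,r)\times\mathbb{R}$ with the identification $r\sim 0$ in the first factor, i.e. the first factor is the circle $\mathbb{R}/r\mathbb{Z}$ of perimeter $r$. Its canonical (lightlike) coordinates are $(x^+,x^-)$ with $0\le x^+<r$ and $x^-\in\mathbb{R}$, and it carries the Lorentzian metric $h=-dx^+\otimes dx^- - dx^-\otimes dx^+$. The metric $h'$ on $C^2_{r'}$ is given by the same expression in the lightlike coordinates of $C^2_{r'}$. *)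

theory Defs
  imports "HOL-Analysis.Analysis"
begin

section \<open>Smooth maps between Euclidean spaces\<close>

text \<open>Only meant for open sets \<open>S\<close>.\<close>

primrec Ck_on :: "nat \<Rightarrow> 'a::euclidean_space set \<Rightarrow> ('a \<Rightarrow> 'b::real_normed_vector) \<Rightarrow> bool" where
  "Ck_on 0 S f \<longleftrightarrow> continuous_on S f"
| "Ck_on (Suc k) S f \<longleftrightarrow> (\<forall>x\<in>S. f differentiable (at x)) \<and>
     (\<forall>v. Ck_on k S (\<lambda>x. frechet_derivative f (at x) v))"

definition smooth_on :: "'a::euclidean_space set \<Rightarrow> ('a \<Rightarrow> 'b::real_normed_vector) \<Rightarrow> bool" where
  "smooth_on S f \<longleftrightarrow> (\<forall>k. Ck_on k S f)"


section \<open>Manifolds with a metric\<close>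

text \<open>A chart is its domain together with a coordinate map, whose values outside
  the domain are irrelevant.\<close>

type_synonym ('a, 'e) chart = "'a set \<times> ('a \<Rightarrow> 'e)"

abbreviation chart_dom :: "('a, 'e) chart \<Rightarrow> 'a set" where
  "chart_dom \<equiv> fst"

abbreviation coord :: "('a, 'e) chart \<Rightarrow> 'a \<Rightarrow> 'e" where
  "coord \<equiv> snd"

definition chart_inv :: "('a, 'e) chart \<Rightarrow> 'e \<Rightarrow> 'a" where
  "chart_inv C = inv_into (chart_dom C) (coord C)"

text \<open>A tangent vector at \<open>p\<close> is encoded by its family of coordinate vectors, one for each
  chart around \<open>p\<close>, transforming with the derivatives of the chart transitions.
  The value at all other charts is normalised to 0.\<close>

type_synonym ('a, 'e) tangent = "('a, 'e) chart \<Rightarrow> 'e"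

record ('a, 'e) metric_manifold =
  points :: "'a set"
  atlas :: "('a, 'e) chart set"
  metric :: "'a \<Rightarrow> ('a, 'e) tangent \<Rightarrow> ('a, 'e) tangent \<Rightarrow> real"

definition tangent_space ::
    "('a, 'e::euclidean_space) metric_manifold \<Rightarrow> 'a \<Rightarrow> ('a, 'e) tangent set" where
  "tangent_space M p = {X.
     (\<forall>C\<in>atlas M. \<forall>D\<in>atlas M. p \<in> chart_dom C \<inter> chart_dom D \<longrightarrow>
        X D = frechet_derivative (coord D \<circ> chart_inv C) (at (coord C p)) (X C)) \<and>
     (\<forall>C. \<not> (C \<in> atlas M \<and> p \<in> chart_dom C) \<longrightarrow> X C = 0)}"

definition chart_vector ::
    "('a, 'e::euclidean_space) metric_manifold \<Rightarrow> ('a, 'e) chart \<Rightarrow> 'a \<Rightarrow> 'e \<Rightarrow> ('a, 'e) tangent" where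
  "chart_vector M C p v = (\<lambda>D. if D \<in> atlas M \<and> p \<in> chart_dom D
     then frechet_derivative (coord D \<circ> chart_inv C) (at (coord C p)) v else 0)"

definition manifold_topology :: "('a, 'e::euclidean_space) metric_manifold \<Rightarrow> 'a topology" where
  "manifold_topology M = topology (\<lambda>W. W \<subseteq> points M \<and>
     (\<forall>C\<in>atlas M. open (coord C ` (W \<inter> chart_dom C))))"

definition smooth_manifold :: "('a, 'e::euclidean_space) metric_manifold \<Rightarrow> bool" where
  "smooth_manifold M \<longleftrightarrow>
     (\<Union>C\<in>atlas M. chart_dom C) = points M \<and>
     (\<forall>C\<in>atlas M. inj_on (coord C) (chart_dom C) \<and> open (coord C ` chart_dom C)) \<and>
     (\<forall>C\<in>atlas M. \<forall>D\<in>atlas M.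
        open (coord C ` (chart_dom C \<inter> chart_dom D)) \<and>
        smooth_on (coord C ` (chart_dom C \<inter> chart_dom D)) (coord D \<circ> chart_inv C)) \<and>
     Hausdorff_space (manifold_topology M) \<and> second_countable (manifold_topology M)"

definition metric_coeff ::
    "('a, 'e::euclidean_space) metric_manifold \<Rightarrow> ('a, 'e) chart \<Rightarrow> 'a \<Rightarrow> 'e \<Rightarrow> 'e \<Rightarrow> real" where
  "metric_coeff M C p v w = metric M p (chart_vector M C p v) (chart_vector M C p w)"

text \<open>Signature \<open>(-, +, \<dots>, +)\<close>: there is a timelike vector whose orthogonal complement
  is positive definite.\<close>

definition lorentzian_form :: "('e::euclidean_space \<Rightarrow> 'e \<Rightarrow> real) \<Rightarrow> bool" where
  "lorentzian_form g \<longleftrightarrow> bilinear g \<and> (\<forall>v w. g v w = g w v) \<and>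
     (\<exists>e. g e e < 0 \<and> (\<forall>v. g e v = 0 \<and> v \<noteq> 0 \<longrightarrow> g v v > 0))"

definition lorentzian_manifold :: "('a, 'e::euclidean_space) metric_manifold \<Rightarrow> bool" where
  "lorentzian_manifold M \<longleftrightarrow> smooth_manifold M \<and>
     (\<forall>C\<in>atlas M. \<forall>p\<in>chart_dom C. lorentzian_form (metric_coeff M C p)) \<and>
     (\<forall>C\<in>atlas M. \<forall>v w. smooth_on (coord C ` chart_dom C)
        (\<lambda>x. metric_coeff M C (chart_inv C x) v w))"


section \<open>Smooth maps, pullbacks and isometries\<close>

definition smooth_map ::
    "('a, 'e::euclidean_space) metric_manifold \<Rightarrow> ('b, 'f::euclidean_space) metric_manifold \<Rightarrow>
     ('a \<Rightarrow> 'b) \<Rightarrow> bool" where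
  "smooth_map M N \<phi> \<longleftrightarrow> \<phi> ` points M \<subseteq> points N \<and>
     (\<forall>C\<in>atlas M. \<forall>D\<in>atlas N.
        open (coord C ` (chart_dom C \<inter> \<phi> -` chart_dom D)) \<and>
        smooth_on (coord C ` (chart_dom C \<inter> \<phi> -` chart_dom D)) (coord D \<circ> \<phi> \<circ> chart_inv C))"

definition diffeomorphism ::
    "('a, 'e::euclidean_space) metric_manifold \<Rightarrow> ('b, 'f::euclidean_space) metric_manifold \<Rightarrow>
     ('a \<Rightarrow> 'b) \<Rightarrow> bool" where
  "diffeomorphism M N \<phi> \<longleftrightarrow> bij_betw \<phi> (points M) (points N) \<and>
     smooth_map M N \<phi> \<and> smooth_map N M (inv_into (points M) \<phi>)"

text \<open>The differential at \<open>p\<close> is computed in some chart around \<open>p\<close>; for smooth maps and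
  vectors in the tangent space the choice does not matter.\<close>

definition differential ::
    "('a, 'e::euclidean_space) metric_manifold \<Rightarrow> ('b, 'f::euclidean_space) metric_manifold \<Rightarrow>
     ('a \<Rightarrow> 'b) \<Rightarrow> 'a \<Rightarrow> ('a, 'e) tangent \<Rightarrow> ('b, 'f) tangent" where
  "differential M N \<phi> p X = (\<lambda>D. if D \<in> atlas N \<and> \<phi> p \<in> chart_dom D
     then let C = (SOME C. C \<in> atlas M \<and> p \<in> chart_dom C)
       in frechet_derivative (coord D \<circ> \<phi> \<circ> chart_inv C) (at (coord C p)) (X C)
     else 0)"

definition pullback_metric ::
    "('a, 'e::euclidean_space) metric_manifold \<Rightarrow> ('b, 'f::euclidean_space) metric_manifold \<Rightarrow>
     ('a \<Rightarrow> 'b) \<Rightarrow> 'a \<Rightarrow> ('a, 'e) tangent \<Rightarrow> ('a, 'e) tangent \<Rightarrow> real" where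
  "pullback_metric M N \<phi> p X Y =
     metric N (\<phi> p) (differential M N \<phi> p X) (differential M N \<phi> p Y)"

definition isometry ::
    "('a, 'e::euclidean_space) metric_manifold \<Rightarrow> ('b, 'f::euclidean_space) metric_manifold \<Rightarrow>
     ('a \<Rightarrow> 'b) \<Rightarrow> bool" where
  "isometry M N \<phi> \<longleftrightarrow> lorentzian_manifold M \<and> lorentzian_manifold N \<and>
     diffeomorphism M N \<phi> \<and>
     (\<forall>p\<in>points M. \<forall>X\<in>tangent_space M p. \<forall>Y\<in>tangent_space M p.
        pullback_metric M N \<phi> p X Y = metric M p X Y)"

definition isometric ::
    "('a, 'e::euclidean_space) metric_manifold \<Rightarrow> ('b, 'f::euclidean_space) metric_manifold \<Rightarrow>
     bool" where
  "isometric M N \<longleftrightarrow> (\<exists>\<phi>. isometry M N \<phi>)"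


section \<open>The Lorentzian cylinders\<close>

text \<open>Every class of the quotient of the plane by \<open>(x, y) \<sim> (x + r, y)\<close> is represented by its
  unique member with first coordinate in \<open>[0, r)\<close>; \<open>cyl_proj r\<close> is the quotient map.\<close>

definition cyl_points :: "real \<Rightarrow> (real \<times> real) set" where
  "cyl_points r = {0..<r} \<times> UNIV"

definition cyl_proj :: "real \<Rightarrow> real \<times> real \<Rightarrow> real \<times> real" where
  "cyl_proj r = (\<lambda>(x, y). (x - r * of_int \<lfloor>x / r\<rfloor>, y))"

text \<open>The charts are the local inverses of the quotient map over the strips
  \<open>(a, a + r) \<times> \<real>\<close>, on which it is injective.  They are lightlike coordinates, the first
  one being defined up to integer multiples of \<open>r\<close>.\<close>

definition cyl_strip :: "real \<Rightarrow> real \<Rightarrow> (real \<times> real) set" where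
  "cyl_strip r a = {a<..<a + r} \<times> UNIV"

definition cyl_chart :: "real \<Rightarrow> real \<Rightarrow> (real \<times> real, real \<times> real) chart" where
  "cyl_chart r a = (cyl_proj r ` cyl_strip r a, inv_into (cyl_strip r a) (cyl_proj r))"

text \<open>The coordinate one-forms, evaluated at \<open>p\<close> in the strip centred at \<open>p\<close>; all charts around
  \<open>p\<close> give the same value on tangent vectors.\<close>

definition dx_plus :: "real \<Rightarrow> real \<times> real \<Rightarrow> (real \<times> real, real \<times> real) tangent \<Rightarrow> real" where
  "dx_plus r p X = fst (X (cyl_chart r (fst p - r / 2)))"

definition dx_minus :: "real \<Rightarrow> real \<times> real \<Rightarrow> (real \<times> real, real \<times> real) tangent \<Rightarrow> real" where
  "dx_minus r p X = snd (X (cyl_chart r (fst p - r / 2)))"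

definition cyl_metric :: "real \<Rightarrow> real \<times> real \<Rightarrow> (real \<times> real, real \<times> real) tangent \<Rightarrow>
    (real \<times> real, real \<times> real) tangent \<Rightarrow> real" where
  "cyl_metric r p X Y = - dx_plus r p X * dx_minus r p Y - dx_minus r p X * dx_plus r p Y"

definition lorentzian_cylinder :: "real \<Rightarrow> (real \<times> real, real \<times> real) metric_manifold" where
  "lorentzian_cylinder r =
     \<lparr>points = cyl_points r, atlas = range (cyl_chart r), metric = cyl_metric r\<rparr>"

end

theory Submission
  imports Defs
begin

text \<open>The linear map \<open>(x, y) \<mapsto> ((r' / r) x, (r / r') y)\<close> of the plane intertwines the translations
  by \<open>(r, 0)\<close> and \<open>(r', 0)\<close>, and it preserves the form \<open>- dx dy - dy dx\<close>.  In all charts of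
  the cylinders its coordinate expressions are locally this linear map plus a constant, so they
  have constant derivative; the chart transitions are the case \<open>r = r'\<close>.\<close>

text \<open>By induction on the order: each directional derivative is constant on \<open>S\<close>,
  hence has derivative zero there, and the same claim applies to it with the zero map in place of
  \<open>L\<close>.\<close>

lemma smooth_on_constant_derivative:
  fixes h :: "'a::euclidean_space \<Rightarrow> 'b::real_normed_vector"
  assumes "open S" and "\<And>x. x \<in> S \<Longrightarrow> (h has_derivative L) (at x)"
  shows "smooth_on S h"
proof -
  have "Ck_on k S h" if "\<And>x. x \<in> S \<Longrightarrow> (h has_derivative L) (at x)" for k h and L :: "'a \<Rightarrow> 'b"
    using that
  proof (induction k arbitrary: h L)
    case 0
    then show ?case
      unfolding Ck_on.simps
      by (intro continuous_at_imp_continuous_on ballI has_derivative_continuous)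
  next
    case (Suc k)
    have fd: "frechet_derivative h (at x) = L" if "x \<in> S" for x
      using frechet_derivative_at[OF Suc.prems[OF that]] by simp
    have "Ck_on k S (\<lambda>x. frechet_derivative h (at x) v)" for v
    proof (rule Suc.IH)
      fix x assume "x \<in> S"
      \<comment> \<open>The function is known to equal \<open>L v\<close> only on \<open>S\<close>;
        since \<open>S\<close> is open, this still determines its derivative at
        \<open>x\<close>.\<close>
      show "((\<lambda>x. frechet_derivative h (at x) v) has_derivative (\<lambda>_. 0)) (at x)"
        by (rule has_derivative_transform_within_open[OF has_derivative_const[of "L v"] \<open>open S\<close> \<open>x \<in> S\<close>])
          (simp add: fd)
    qed
    then show ?case
      using Suc.prems unfolding Ck_on.simps differentiable_def by blast
  qed
  with assms show ?thesis
    unfolding smooth_on_def by blast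
qed


section \<open>The quotient map and the charts\<close>

lemma cyl_proj_in_points:
  assumes "r > 0"
  shows "cyl_proj r z \<in> cyl_points r"
proof -
  have "0 \<le> fst z - r * of_int \<lfloor>fst z / r\<rfloor>" "fst z - r * of_int \<lfloor>fst z / r\<rfloor> < r"
    using floor_divide_lower[OF assms, of "fst z"] floor_divide_upper[OF assms, of "fst z"]
    by (simp_all add: algebra_simps)
  then show ?thesis
    by (simp add: cyl_proj_def cyl_points_def split_beta)
qed

lemma cyl_proj_ident:
  assumes "r > 0" "p \<in> cyl_points r"
  shows "cyl_proj r p = p"
proof -
  have "\<lfloor>fst p / r\<rfloor> = 0"
    using assms by (auto simp: cyl_points_def floor_eq_iff)
  then show ?thesis
    by (simp add: cyl_proj_def split_beta)
qed

text \<open>The fibres of the quotient map are the orbits of the translations by multiples of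
  \<open>(r, 0)\<close>, because the floor commutes with integer shifts. Later arguments use this
  integer \<open>k\<close> rather than floors.\<close>

lemma cyl_proj_eq_iff:
  assumes "r > 0"
  shows "cyl_proj r w = cyl_proj r z \<longleftrightarrow> (\<exists>k::int. w = z + (r * of_int k, 0))"
proof
  assume "cyl_proj r w = cyl_proj r z"
  then have "w = z + (r * of_int (\<lfloor>fst w / r\<rfloor> - \<lfloor>fst z / r\<rfloor>), 0)"
    by (cases w; cases z) (simp add: cyl_proj_def algebra_simps)
  then show "\<exists>k::int. w = z + (r * of_int k, 0)"
    by blast
next
  assume "\<exists>k::int. w = z + (r * of_int k, 0)"
  then obtain k :: int where k: "w = z + (r * of_int k, 0)" ..
  have "\<lfloor>fst w / r\<rfloor> = \<lfloor>fst z / r\<rfloor> + k"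
    using assms by (simp add: k add_divide_distrib)
  then show "cyl_proj r w = cyl_proj r z"
    by (simp add: k cyl_proj_def split_beta algebra_simps)
qed

lemma inj_on_cyl_proj_strip:
  assumes "r > 0"
  shows "inj_on (cyl_proj r) (cyl_strip r a)"
proof (rule inj_onI)
  fix w z assume wz: "w \<in> cyl_strip r a" "z \<in> cyl_strip r a" "cyl_proj r w = cyl_proj r z"
  obtain k :: int where k: "w = z + (r * of_int k, 0)"
    using wz(3) cyl_proj_eq_iff[OF assms] by blast
  have "a < fst w" "fst w < a + r" "a < fst z" "fst z < a + r" "fst w = fst z + r * of_int k"
    using wz(1,2) k by (auto simp: cyl_strip_def mem_Times_iff)
  \<comment> \<open>Two points of an open strip of width \<open>r\<close> differ by less than
    \<open>r\<close>, which leaves only \<open>k = 0\<close>.\<close>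
  then have "r * of_int k < r * 1" "r * (-1) < r * of_int k"
    by linarith+
  then have "of_int k < (1::real)" "(-1::real) < of_int k"
    using assms by (simp_all only: mult_less_cancel_left_pos)
  then have "k = 0"
    by linarith
  with k show "w = z"
    by (simp add: zero_prod_def[symmetric])
qed

lemma open_cyl_strip: "open (cyl_strip r a)"
  unfolding cyl_strip_def by (intro open_Times) auto

lemma cyl_chart_dom: "chart_dom (cyl_chart r a) = cyl_proj r ` cyl_strip r a"
  by (simp add: cyl_chart_def)

lemma cyl_coord_proj:
  "r > 0 \<Longrightarrow> z \<in> cyl_strip r a \<Longrightarrow> coord (cyl_chart r a) (cyl_proj r z) = z"
  by (simp add: cyl_chart_def inj_on_cyl_proj_strip)

lemma cyl_coord_in_strip:
  "r > 0 \<Longrightarrow> p \<in> chart_dom (cyl_chart r a) \<Longrightarrow>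
    coord (cyl_chart r a) p \<in> cyl_strip r a \<and> cyl_proj r (coord (cyl_chart r a) p) = p"
  by (metis cyl_chart_dom cyl_coord_proj imageE)

lemma inj_on_cyl_coord: "r > 0 \<Longrightarrow> inj_on (coord (cyl_chart r a)) (chart_dom (cyl_chart r a))"
  by (rule inj_on_inverseI[where g = "cyl_proj r"]) (simp add: cyl_coord_in_strip)

lemma cyl_chart_inv:
  assumes "r > 0" "z \<in> cyl_strip r a"
  shows "chart_inv (cyl_chart r a) z = cyl_proj r z"
proof -
  have "inv_into (chart_dom (cyl_chart r a)) (coord (cyl_chart r a))
      (coord (cyl_chart r a) (cyl_proj r z)) = cyl_proj r z"
    using assms by (intro inv_into_f_f inj_on_cyl_coord) (auto simp: cyl_chart_dom)
  then show ?thesis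
    using assms by (simp add: chart_inv_def cyl_coord_proj)
qed

text \<open>Turns openness in a chart into openness in the plane, since the coordinate map undoes
  \<open>cyl_proj\<close> on its strip. The case \<open>W = UNIV\<close> gives the whole
  strip.\<close>

lemma cyl_coord_image:
  assumes "r > 0"
  shows "coord (cyl_chart r a) ` (chart_dom (cyl_chart r a) \<inter> W) = cyl_strip r a \<inter> cyl_proj r -` W"
proof -
  have "chart_dom (cyl_chart r a) \<inter> W = cyl_proj r ` (cyl_strip r a \<inter> cyl_proj r -` W)"
    by (auto simp: cyl_chart_dom)
  then show ?thesis
    using assms by (simp add: image_image cyl_coord_proj)
qed

lemma cyl_chart_dom_subset: "r > 0 \<Longrightarrow> chart_dom (cyl_chart r a) \<subseteq> cyl_points r"
  by (auto simp: cyl_chart_dom cyl_proj_in_points)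

lemma in_centered_strip: "r > 0 \<Longrightarrow> z \<in> cyl_strip r (fst z - r / 2)"
  by (cases z) (simp add: cyl_strip_def)

lemma in_centered_chart_dom:
  "r > 0 \<Longrightarrow> p \<in> cyl_points r \<Longrightarrow> p \<in> chart_dom (cyl_chart r (fst p - r / 2))"
  using cyl_proj_ident[of r p] in_centered_strip[of r p] unfolding cyl_chart_dom by (metis imageI)

text \<open>The saturation of \<open>U\<close> is the union of its translates by multiples of
  \<open>(r, 0)\<close>. This is what makes the quotient map open.\<close>

lemma open_vimage_cyl_proj_image:
  assumes "r > 0" "open U"
  shows "open (cyl_proj r -` (cyl_proj r ` U))"
proof -
  have "cyl_proj r -` (cyl_proj r ` U) = (\<Union>k::int. (\<lambda>z. z + (r * of_int k, 0)) -` U)"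
  proof (rule set_eqI)
    fix z
    have "z \<in> cyl_proj r -` (cyl_proj r ` U) \<longleftrightarrow> (\<exists>u\<in>U. cyl_proj r u = cyl_proj r z)"
      unfolding vimage_eq image_iff by metis
    also have "\<dots> \<longleftrightarrow> z \<in> (\<Union>k::int. (\<lambda>z. z + (r * of_int k, 0)) -` U)"
      using assms(1) by (auto simp: cyl_proj_eq_iff)
    finally show "z \<in> cyl_proj r -` (cyl_proj r ` U) \<longleftrightarrow> \<dots>" .
  qed
  also have "open \<dots>"
    using assms(2) by (intro open_UN ballI open_vimage continuous_intros) auto
  finally show ?thesis .
qed


section \<open>The rescaling map in charts\<close>

text \<open>Defined on the whole plane, so that one linear map serves as point map, as its lift to
  the covering plane and as its derivative.\<close>

definition rescale :: "real \<Rightarrow> real \<Rightarrow> real \<times> real \<Rightarrow> real \<times> real" where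
  "rescale r r' = (\<lambda>(x, y). ((r' / r) * x, (r / r') * y))"

lemma bounded_linear_rescale: "bounded_linear (rescale r r')"
  unfolding rescale_def split_beta
  by (intro bounded_linear_Pair bounded_linear_const_mult bounded_linear_fst bounded_linear_snd)

lemma rescale_self: "r > 0 \<Longrightarrow> rescale r r = (\<lambda>z. z)"
  by (auto simp: rescale_def)

text \<open>Dividing the rescaled first coordinate by \<open>r'\<close> gives \<open>x / r\<close>
  again, so the same integer number of periods is removed on both sides.\<close>

lemma rescale_cyl_proj:
  assumes "r > 0" "r' > 0"
  shows "rescale r r' (cyl_proj r z) = cyl_proj r' (rescale r r' z)"
  using assms by (cases z) (simp add: rescale_def cyl_proj_def field_simps)

text \<open>Near \<open>x\<close> the coordinate expression is \<open>rescale r r'\<close> plus a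
  fixed multiple of the period \<open>r'\<close>. Prescribing \<phi> only on
  \<open>cyl_points r\<close> lets the lemma cover the identity, the rescaling and its
  \<open>inv_into\<close> inverse alike.\<close>

lemma has_derivative_rescale_in_charts:
  assumes r: "r > 0" "r' > 0" and \<phi>: "\<And>p. p \<in> cyl_points r \<Longrightarrow> \<phi> p = rescale r r' p"
    and x: "x \<in> cyl_strip r a" "\<phi> (cyl_proj r x) \<in> chart_dom (cyl_chart r' b)"
  shows "((coord (cyl_chart r' b) \<circ> \<phi> \<circ> chart_inv (cyl_chart r a)) has_derivative rescale r r') (at x)"
proof -
  have \<phi>_proj: "\<phi> (cyl_proj r z) = cyl_proj r' (rescale r r' z)" for z
    using r by (simp add: \<phi> cyl_proj_in_points rescale_cyl_proj)
  obtain z where z: "z \<in> cyl_strip r' b" "cyl_proj r' z = cyl_proj r' (rescale r r' x)"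
    using x(2) by (auto simp: cyl_chart_dom \<phi>_proj)
  then obtain k :: int where k: "z = rescale r r' x + (r' * of_int k, 0)"
    using cyl_proj_eq_iff[OF r(2)] by blast
  \<comment> \<open>The open set of points for which the integer \<open>k\<close> found at
    \<open>x\<close> still lands in the target strip.\<close>
  define T where "T = (\<lambda>y. rescale r r' y + (r' * of_int k, 0)) -` cyl_strip r' b \<inter> cyl_strip r a"
  have cont: "continuous_on UNIV (rescale r r')"
    by (simp add: bounded_linear_rescale linear_continuous_on)
  have "open T"
    unfolding T_def by (intro open_Int open_vimage open_cyl_strip continuous_intros cont)
  moreover have "x \<in> T"
    using x z k by (simp add: T_def)
  moreover have "rescale r r' y + (r' * of_int k, 0) =
      (coord (cyl_chart r' b) \<circ> \<phi> \<circ> chart_inv (cyl_chart r a)) y" if "y \<in> T" for y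
  proof -
    have "cyl_proj r' (rescale r r' y) = cyl_proj r' (rescale r r' y + (r' * of_int k, 0))"
      using cyl_proj_eq_iff[OF r(2)] by metis
    with that r show ?thesis
      by (simp add: T_def cyl_chart_inv \<phi>_proj cyl_coord_proj)
  qed
  moreover have "((\<lambda>y. rescale r r' y + (r' * of_int k, 0)) has_derivative rescale r r') (at x)"
    using has_derivative_add[OF bounded_linear_imp_has_derivative[OF bounded_linear_rescale]
        has_derivative_const] by simp
  ultimately show ?thesis
    by (metis (no_types, lifting) has_derivative_transform_within_open)
qed

lemma smooth_rescale_in_charts:
  assumes r: "r > 0" "r' > 0" and \<phi>: "\<And>p. p \<in> cyl_points r \<Longrightarrow> \<phi> p = rescale r r' p"
  defines "S \<equiv> \<lambda>a b. coord (cyl_chart r a) `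
    (chart_dom (cyl_chart r a) \<inter> \<phi> -` chart_dom (cyl_chart r' b))"
  shows "open (S a b) \<and>
    smooth_on (S a b) (coord (cyl_chart r' b) \<circ> \<phi> \<circ> chart_inv (cyl_chart r a))"
proof
  have S: "S a b = cyl_strip r a \<inter> cyl_proj r -` (\<phi> -` chart_dom (cyl_chart r' b))"
    unfolding S_def by (rule cyl_coord_image[OF r(1)])
  \<comment> \<open>Values of \<open>cyl_proj r\<close> are points of the cylinder, so \<phi> may be
    replaced by \<open>rescale\<close>, which is then moved past the quotient map; what remains is
    the preimage of an open saturated set.\<close>
  also have "\<dots> = cyl_strip r a \<inter> rescale r r' -` (cyl_proj r' -` (cyl_proj r' ` cyl_strip r' b))"
    using r by (simp add: vimage_def \<phi> cyl_proj_in_points rescale_cyl_proj cyl_chart_dom)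
  finally have "S a b = \<dots>" .
  moreover have "continuous_on UNIV (rescale r r')"
    by (simp add: bounded_linear_rescale linear_continuous_on)
  ultimately show "open (S a b)"
    using r by (simp add: open_Int open_vimage open_cyl_strip open_vimage_cyl_proj_image)
  then show "smooth_on (S a b) (coord (cyl_chart r' b) \<circ> \<phi> \<circ> chart_inv (cyl_chart r a))"
    by (rule smooth_on_constant_derivative) (use S in \<open>auto intro!: has_derivative_rescale_in_charts r \<phi>\<close>)
qed

text \<open>The case of equal perimeters: transitions are locally translations, so a tangent vector
  has the same components in all charts around its point.\<close>

lemma has_derivative_cyl_transition:
  assumes "r > 0" "p \<in> chart_dom (cyl_chart r a)" "p \<in> chart_dom (cyl_chart r b)"
  shows "((coord (cyl_chart r b) \<circ> chart_inv (cyl_chart r a)) has_derivative (\<lambda>v. v))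
    (at (coord (cyl_chart r a) p))"
  using has_derivative_rescale_in_charts[of r r "\<lambda>x. x" "coord (cyl_chart r a) p" a b]
    cyl_coord_in_strip[of r p a] assms by (simp add: rescale_self comp_def)


section \<open>The cylinders are Lorentzian manifolds\<close>

lemma lorentzian_cylinder_simps [simp]:
  "points (lorentzian_cylinder r) = cyl_points r"
  "atlas (lorentzian_cylinder r) = range (cyl_chart r)"
  "metric (lorentzian_cylinder r) = cyl_metric r"
  by (simp_all add: lorentzian_cylinder_def)

section \<open>The manifold topology as the quotient topology of the plane\<close>

lemma openin_cyl_topology:
  assumes "r > 0"
  shows "openin (manifold_topology (lorentzian_cylinder r)) W \<longleftrightarrow>
    W \<subseteq> cyl_points r \<and> open (cyl_proj r -` W)"
proof -
  define P where "P = (\<lambda>W. W \<subseteq> cyl_points r \<and> open (cyl_proj r -` W))"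
  have "(\<forall>a. open (coord (cyl_chart r a) ` (W \<inter> chart_dom (cyl_chart r a)))) \<longleftrightarrow>
      open (cyl_proj r -` W)" for W
  proof -
    \<comment> \<open>The strips cover the plane, so openness in every chart amounts to openness of
      the full preimage.\<close>
    have eq: "cyl_proj r -` W = (\<Union>a. cyl_strip r a \<inter> cyl_proj r -` W)"
      using in_centered_strip[OF assms] by blast
    show ?thesis
      unfolding Int_commute[of W] cyl_coord_image[OF assms]
      by (metis eq open_UN open_Int open_cyl_strip)
  qed
  then have "manifold_topology (lorentzian_cylinder r) = topology P"
    by (simp add: manifold_topology_def P_def)
  moreover have "istopology P"
    by (auto simp: istopology_def P_def vimage_Union intro!: open_Int open_UN)
  ultimately show ?thesis
    by (simp add: topology_inverse' P_def)
qed

lemma topspace_cyl_topology: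
  assumes "r > 0"
  shows "topspace (manifold_topology (lorentzian_cylinder r)) = cyl_points r"
proof -
  have "cyl_proj r -` cyl_points r = UNIV"
    using assms by (auto simp: cyl_proj_in_points)
  then have "openin (manifold_topology (lorentzian_cylinder r)) (cyl_points r)"
    using assms by (simp add: openin_cyl_topology)
  then show ?thesis
    using assms openin_cyl_topology openin_subset openin_topspace by (metis subset_antisym)
qed

text \<open>The quotient map is a continuous open surjection from the plane, so second countability
  passes to the cylinder.\<close>

lemma second_countable_cyl_topology:
  assumes "r > 0"
  shows "second_countable (manifold_topology (lorentzian_cylinder r))"
proof (rule second_countable_open_map_image)
  let ?T = "manifold_topology (lorentzian_cylinder r)"
  show "continuous_map euclidean ?T (cyl_proj r)"
    using assms by (auto simp: continuous_map_def openin_cyl_topology topspace_cyl_topology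
        cyl_proj_in_points vimage_def)
  show "open_map euclidean ?T (cyl_proj r)"
    using assms by (auto simp: open_map_def openin_cyl_topology open_vimage_cyl_proj_image
        cyl_proj_in_points)
  show "cyl_proj r ` topspace euclidean = topspace ?T"
  proof
    show "cyl_proj r ` topspace euclidean \<subseteq> topspace ?T"
      using assms by (simp add: topspace_cyl_topology image_subset_iff cyl_proj_in_points)
    show "topspace ?T \<subseteq> cyl_proj r ` topspace euclidean"
      unfolding topspace_cyl_topology[OF assms] topspace_euclidean
      using cyl_proj_ident[OF assms] by (metis rangeI subsetI)
  qed
  show "second_countable (euclidean :: (real \<times> real) topology)"
    using ex_countable_basis unfolding second_countable_def
    by (metis open_openin topological_basisE topological_basis_open)
qed

lemma Hausdorff_cyl_topology:
  assumes "r > 0"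
  shows "Hausdorff_space (manifold_topology (lorentzian_cylinder r))"
proof (rule Hausdorff_space_injective_preimage)
  let ?T = "manifold_topology (lorentzian_cylinder r)"
  \<comment> \<open>Wrapping the first coordinate around the unit circle gives a map with the same
    fibres as \<open>cyl_proj r\<close>, hence an injection of the cylinder into a Hausdorff
    space.\<close>
  define F where "F = (\<lambda>z :: real \<times> real. (cis (2 * pi * fst z / r), snd z))"
  have F_eq_iff: "F w = F z \<longleftrightarrow> cyl_proj r w = cyl_proj r z" for w z
  proof -
    have "2 * pi * fst w / r = 2 * pi * fst z / r + 2 * pi * of_int k \<longleftrightarrow>
        fst w = fst z + r * of_int k" for k :: int
    proof -
      have "2 * pi * fst w / r = 2 * pi * fst z / r + 2 * pi * of_int k \<longleftrightarrow>
        (2 * pi) * fst w = (2 * pi) * (fst z + r * of_int k)"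
        using assms by (simp add: field_simps)
      then show ?thesis
        by (simp only: mult_cancel_left) simp
    qed
    then show ?thesis
      unfolding F_def cyl_proj_eq_iff[OF assms]
      \<comment> \<open>Equality of complex numbers yields the cosine equation first; the swap fits
        it to \<open>sin_cos_eq_iff\<close>.\<close>
      by (simp add: complex_eq_iff conj_commute[of "cos _ = _"] sin_cos_eq_iff prod_eq_iff)
  qed
  show "inj_on F (topspace ?T)"
    using assms by (auto intro!: inj_onI simp: topspace_cyl_topology F_eq_iff cyl_proj_ident)
  show "continuous_map ?T euclidean F"
  proof -
    have "open (cyl_proj r -` {z \<in> cyl_points r. F z \<in> U})" if "open U" for U
    proof -
      \<comment> \<open>Constancy on fibres reduces continuity on the quotient to continuity of
        \<open>F\<close> on the plane, avoiding the jump of the representatives at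
        \<open>0\<close>.\<close>
      have "F (cyl_proj r z) = F z" for z
        using assms by (simp add: F_eq_iff cyl_proj_ident cyl_proj_in_points)
      then have "cyl_proj r -` {z \<in> cyl_points r. F z \<in> U} = F -` U"
        using assms by (auto simp: cyl_proj_in_points)
      also have "open (F -` U)"
        unfolding F_def using that assms by (intro open_vimage continuous_intros) auto
      finally show ?thesis .
    qed
    then show ?thesis
      using assms by (auto simp: continuous_map_def openin_cyl_topology topspace_cyl_topology)
  qed
qed (rule Hausdorff_space_euclidean)

section \<open>Smooth structure and Lorentzian metric of the cylinders\<close>

lemma smooth_manifold_cylinder:
  assumes "r > 0"
  shows "smooth_manifold (lorentzian_cylinder r)"
  unfolding smooth_manifold_def
proof (intro conjI)
  show "(\<Union>C\<in>atlas (lorentzian_cylinder r). chart_dom C) = points (lorentzian_cylinder r)"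
    using cyl_chart_dom_subset[OF assms] in_centered_chart_dom[OF assms] by auto blast
  show "\<forall>C\<in>atlas (lorentzian_cylinder r).
      inj_on (coord C) (chart_dom C) \<and> open (coord C ` chart_dom C)"
    using assms cyl_coord_image[OF assms, of _ UNIV] by (simp add: inj_on_cyl_coord open_cyl_strip)
  show "\<forall>C\<in>atlas (lorentzian_cylinder r). \<forall>D\<in>atlas (lorentzian_cylinder r).
      open (coord C ` (chart_dom C \<inter> chart_dom D)) \<and>
      smooth_on (coord C ` (chart_dom C \<inter> chart_dom D)) (coord D \<circ> chart_inv C)"
    using smooth_rescale_in_charts[OF assms assms, of "\<lambda>x. x"] assms
    by (simp add: rescale_self comp_def)
qed (use assms in \<open>simp_all add: Hausdorff_cyl_topology second_countable_cyl_topology\<close>)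

lemma metric_coeff_cylinder:
  assumes "r > 0" "p \<in> chart_dom (cyl_chart r a)"
  shows "metric_coeff (lorentzian_cylinder r) (cyl_chart r a) p v w =
    - fst v * snd w - snd v * fst w"
proof -
  have p: "p \<in> chart_dom (cyl_chart r (fst p - r / 2))"
    using assms cyl_chart_dom_subset in_centered_chart_dom by blast
  \<comment> \<open>The metric reads components in the chart centred at \<open>p\<close>; the
    transition from chart \<open>a\<close> does not change them.\<close>
  have "chart_vector (lorentzian_cylinder r) (cyl_chart r a) p u (cyl_chart r (fst p - r / 2)) = u"
    for u
    using p frechet_derivative_at[OF has_derivative_cyl_transition[OF assms p], symmetric]
    by (simp add: chart_vector_def)
  then show ?thesis
    by (simp add: metric_coeff_def cyl_metric_def dx_plus_def dx_minus_def)
qed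

lemma lorentzian_form_lightlike:
  "lorentzian_form (\<lambda>v w :: real \<times> real. - fst v * snd w - snd v * fst w)"
  unfolding lorentzian_form_def
\<comment> \<open>The vector \<open>(1, 1)\<close> has square \<open>-2\<close>, and its orthogonal
  complement consists of the vectors \<open>(s, -s)\<close>, of square
  \<open>2 * s^2\<close>.\<close>
proof (intro conjI exI[of _ "(1, 1)"] allI impI)
  show "bilinear (\<lambda>v w :: real \<times> real. - fst v * snd w - snd v * fst w)"
    unfolding bilinear_def by (auto intro!: linearI simp: algebra_simps)
next
  fix v :: "real \<times> real"
  assume v: "- fst (1, 1) * snd v - snd (1, 1) * fst v = 0 \<and> v \<noteq> 0"
  then have "snd v = - fst v" "fst v \<noteq> 0"
    by (auto simp: prod_eq_iff)
  then show "- fst v * snd v - snd v * fst v > 0"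
    by simp (metis mult_eq_0_iff not_real_square_gt_zero)
qed auto

lemma lorentzian_manifold_cylinder:
  assumes "r > 0"
  shows "lorentzian_manifold (lorentzian_cylinder r)"
proof -
  have "lorentzian_form (metric_coeff (lorentzian_cylinder r) (cyl_chart r a) p)"
    if "p \<in> chart_dom (cyl_chart r a)" for a p
    using lorentzian_form_lightlike metric_coeff_cylinder[OF assms that] by presburger
  moreover have "smooth_on (coord (cyl_chart r a) ` chart_dom (cyl_chart r a))
      (\<lambda>x. metric_coeff (lorentzian_cylinder r) (cyl_chart r a) (chart_inv (cyl_chart r a) x) v w)"
    for a v w
  proof -
    let ?g = "\<lambda>x. metric_coeff (lorentzian_cylinder r) (cyl_chart r a) (chart_inv (cyl_chart r a) x) v w"
    have eq: "?g x = - fst v * snd w - snd v * fst w" if "x \<in> cyl_strip r a" for x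
      using assms that by (simp add: cyl_chart_inv metric_coeff_cylinder cyl_chart_dom)
    have "(?g has_derivative (\<lambda>_. 0)) (at x)" if "x \<in> cyl_strip r a" for x
      by (rule has_derivative_transform_within_open[OF has_derivative_const open_cyl_strip that])
        (simp only: eq)
    then have "smooth_on (cyl_strip r a) ?g"
      by (rule smooth_on_constant_derivative[OF open_cyl_strip])
    then show ?thesis
      using cyl_coord_image[OF assms, of a UNIV] by simp
  qed
  ultimately show ?thesis
    using assms by (simp add: lorentzian_manifold_def smooth_manifold_cylinder)
qed


section \<open>The rescaling map is an isometry\<close>

lemma bij_betw_rescale:
  assumes "r > 0" "r' > 0"
  shows "bij_betw (rescale r r') (cyl_points r) (cyl_points r')"
  using assms by (intro bij_betw_byWitness[where f' = "rescale r' r"])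
    (auto simp: rescale_def cyl_points_def field_simps)

lemma smooth_map_rescale:
  assumes r: "r > 0" "r' > 0" and \<phi>: "\<And>p. p \<in> cyl_points r \<Longrightarrow> \<phi> p = rescale r r' p"
  shows "smooth_map (lorentzian_cylinder r) (lorentzian_cylinder r') \<phi>"
proof -
  have "\<phi> ` cyl_points r \<subseteq> cyl_points r'"
    using \<phi> bij_betw_rescale[OF r] by (auto simp: bij_betw_def)
  then show ?thesis
    using smooth_rescale_in_charts[OF r \<phi>] by (simp add: smooth_map_def)
qed

lemma diffeomorphism_rescale:
  assumes "r > 0" "r' > 0"
  shows "diffeomorphism (lorentzian_cylinder r) (lorentzian_cylinder r') (rescale r r')"
proof -
  \<comment> \<open>The agreement is claimed on the cylinder only, as
    \<open>smooth_map_rescale\<close> demands.\<close>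
  have "inv_into (cyl_points r) (rescale r r') q = rescale r' r q" if "q \<in> cyl_points r'" for q
  proof (rule inv_into_f_eq)
    show "inj_on (rescale r r') (cyl_points r)"
      using bij_betw_rescale[OF assms] by (simp add: bij_betw_def)
    show "rescale r' r q \<in> cyl_points r"
      using bij_betw_rescale[OF assms(2,1)] that by (auto simp: bij_betw_def)
    show "rescale r r' (rescale r' r q) = q"
      using assms by (simp add: rescale_def split_beta)
  qed
  with assms show ?thesis
    by (simp add: diffeomorphism_def bij_betw_rescale smooth_map_rescale)
qed

lemma pullback_metric_rescale:
  assumes r: "r > 0" "r' > 0" and p: "p \<in> cyl_points r"
    and "X \<in> tangent_space (lorentzian_cylinder r) p" "Y \<in> tangent_space (lorentzian_cylinder r) p"
  shows "pullback_metric (lorentzian_cylinder r) (lorentzian_cylinder r') (rescale r r') p X Y =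
    cyl_metric r p X Y"
proof -
  let ?C = "cyl_chart r (fst p - r / 2)"
  let ?D = "cyl_chart r' (fst (rescale r r' p) - r' / 2)"
  have D: "rescale r r' p \<in> chart_dom ?D"
    using bij_betw_apply[OF bij_betw_rescale[OF r] p] by (rule in_centered_chart_dom[OF r(2)])
  have C: "p \<in> chart_dom ?C"
    using in_centered_chart_dom[OF r(1) p] .
  have diff: "differential (lorentzian_cylinder r) (lorentzian_cylinder r') (rescale r r') p Z ?D =
      rescale r r' (Z ?C)" if Z: "Z \<in> tangent_space (lorentzian_cylinder r) p" for Z
  proof -
    \<comment> \<open>The differential is computed in this arbitrarily chosen chart, the metric in
      the centred chart \<open>?C\<close>; tangency of \<open>Z\<close> and the trivial transition
      derivative identify the components.\<close>
    define B where "B = (SOME B. B \<in> atlas (lorentzian_cylinder r) \<and> p \<in> chart_dom B)"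
    have B: "B \<in> atlas (lorentzian_cylinder r) \<and> p \<in> chart_dom B"
      unfolding B_def by (rule someI[of _ ?C]) (use C in simp)
    then obtain a where a: "B = cyl_chart r a" "p \<in> chart_dom (cyl_chart r a)"
      by auto
    have "?C \<in> atlas (lorentzian_cylinder r)"
      by simp
    then have "Z ?C = frechet_derivative (coord ?C \<circ> chart_inv B) (at (coord B p)) (Z B)"
      using Z B C unfolding tangent_space_def by blast
    also have "\<dots> = Z B"
      using frechet_derivative_at[OF has_derivative_cyl_transition[OF r(1) a(2) C], symmetric] a
      by simp
    finally have ZB: "Z B = Z ?C" ..
    have deriv: "((coord ?D \<circ> rescale r r' \<circ> chart_inv B) has_derivative rescale r r') (at (coord B p))"
      unfolding a(1) using cyl_coord_in_strip[OF r(1) a(2)] D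
      by (intro has_derivative_rescale_in_charts r) auto
    have "differential (lorentzian_cylinder r) (lorentzian_cylinder r') (rescale r r') p Z ?D =
        frechet_derivative (coord ?D \<circ> rescale r r' \<circ> chart_inv B) (at (coord B p)) (Z B)"
      unfolding differential_def B_def[symmetric] Let_def using D by simp
    then show ?thesis
      by (simp only: frechet_derivative_at[OF deriv, symmetric] ZB)
  qed
  show ?thesis
    \<comment> \<open>Each term of the metric multiplies a plus component by a minus component, so
      the factors \<open>r' / r\<close> and \<open>r / r'\<close> cancel.\<close>
    using assms by (simp add: pullback_metric_def cyl_metric_def dx_plus_def dx_minus_def diff)
      (simp add: rescale_def split_beta)
qed

lemma isometry_rescale:
  assumes "r > 0" "r' > 0"
  shows "isometry (lorentzian_cylinder r) (lorentzian_cylinder r') (rescale r r')"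
  using assms by (simp add: isometry_def lorentzian_manifold_cylinder diffeomorphism_rescale
      pullback_metric_rescale)

theorem mainTheorem3:
  fixes r r' :: real
  assumes "r > 0" and "r' > 0"
  shows "isometric (lorentzian_cylinder r) (lorentzian_cylinder r') \<and>
    isometry (lorentzian_cylinder r) (lorentzian_cylinder r')
      (\<lambda>(x_plus, x_minus). ((r' / r) * x_plus, (r / r') * x_minus))"
  using isometry_rescale[OF assms] unfolding rescale_def isometric_def by blast

end
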